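(* Let $M$ be a regular irreducible algebraic submonoid of $M_n(\mathbb{C})$ and let $a\in M$. Then the Green classes $L_a^M$ and $R_a^M$ of $a$ in $M$ are submanifolds of $M_n(\mathbb{C})$.
   Context: $M_n(\mathbb{C})$ is the multiplicative monoid of $n\times n$ complex matrices, identified with $\mathbb{C}^{n^2}$. An algebraic submonoid $M$ of $M_n(\mathbb{C})$ is a submonoid (containing the identity matrix) that is the zero set of a collection of polynomials in the $n^2$ matrix entries; it is irreducible if it is not the union of two proper algebraic subsets, and regular if for every $a\in M$ there is $x\in M$ with $axa=a$. $L_a^M=\{b\in M: Mb=Ma\}$ and $R_a^M=\{b\in M: bM=aM\}$ are the $\mathscr L$- and $\mathscr R$-classes of $a$ computed in $M$. All topological terms refer to the euclidean topology; manifolds are complex analytic, and a submanifold is an embedded one (carrying the subspace topology). *)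

theory Defs
  imports "HOL-Analysis.Analysis"
begin

text \<open>
  \<open>M\<^sub>n(\<complex>)\<close> is the type \<open>complex^'n^'n\<close> with \<open>n = CARD('n)\<close>, multiplication \<open>**\<close> and
  identity \<open>mat 1\<close>; the topology of this type is the euclidean one.
\<close>

type_synonym 'n cmat = "complex^'n^'n"

section \<open>Algebraic sets and algebraic monoids\<close>

text \<open>
  Finite linear combinations of monomials in the \<open>n\<^sup>2\<close> matrix entries; a monomial is given by its
  matrix \<open>e\<close> of exponents.
\<close>

definition polynomial_fun :: "('n::finite cmat \<Rightarrow> complex) \<Rightarrow> bool" where
  "polynomial_fun p \<longleftrightarrow>
     (\<exists>(E :: ('n \<Rightarrow> 'n \<Rightarrow> nat) set) (c :: ('n \<Rightarrow> 'n \<Rightarrow> nat) \<Rightarrow> complex). finite E \<and>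
        (\<forall>A. p A = (\<Sum>e\<in>E. c e * (\<Prod>i\<in>UNIV. \<Prod>j\<in>UNIV. (A $ i $ j) ^ e i j))))"

definition algebraic_set :: "'n::finite cmat set \<Rightarrow> bool" where
  "algebraic_set X \<longleftrightarrow>
     (\<exists>P. (\<forall>p\<in>P. polynomial_fun p) \<and> X = {A. \<forall>p\<in>P. p A = 0})"

definition irreducible_set :: "'n::finite cmat set \<Rightarrow> bool" where
  "irreducible_set X \<longleftrightarrow>
     \<not> (\<exists>Y Z. algebraic_set Y \<and> algebraic_set Z \<and> Y \<subset> X \<and> Z \<subset> X \<and> X = Y \<union> Z)"

definition matrix_submonoid :: "'n::finite cmat set \<Rightarrow> bool" where
  "matrix_submonoid M \<longleftrightarrow> mat 1 \<in> M \<and> (\<forall>a\<in>M. \<forall>b\<in>M. a ** b \<in> M)"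

definition algebraic_submonoid :: "'n::finite cmat set \<Rightarrow> bool" where
  "algebraic_submonoid M \<longleftrightarrow> matrix_submonoid M \<and> algebraic_set M"

definition regular_monoid :: "'n::finite cmat set \<Rightarrow> bool" where
  "regular_monoid M \<longleftrightarrow> (\<forall>a\<in>M. \<exists>x\<in>M. a ** x ** a = a)"

definition L_class :: "'n::finite cmat set \<Rightarrow> 'n cmat \<Rightarrow> 'n cmat set" where
  "L_class M a = {b\<in>M. (\<lambda>m. m ** b) ` M = (\<lambda>m. m ** a) ` M}"

definition R_class :: "'n::finite cmat set \<Rightarrow> 'n cmat \<Rightarrow> 'n cmat set" where
  "R_class M a = {b\<in>M. (\<lambda>m. b ** m) ` M = (\<lambda>m. a ** m) ` M}"

section \<open>Complex submanifolds\<close>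

text \<open>
  A map of several complex variables is holomorphic if it is complex differentiable at every
  point, i.e. if its (real) Frechet derivative is complex linear. The domain \<open>U\<close> is always open
  in what follows.
\<close>

definition holomorphic_map :: "'n::finite cmat set \<Rightarrow> ('n cmat \<Rightarrow> 'n cmat) \<Rightarrow> bool" where
  "holomorphic_map U f \<longleftrightarrow>
     (\<forall>A\<in>U. \<exists>D. (f has_derivative D) (at A) \<and>
        (\<forall>(c::complex) X. D (map_matrix ((*) c) X) = map_matrix ((*) c) (D X)))"

definition biholomorphism ::
  "'n::finite cmat set \<Rightarrow> 'n cmat set \<Rightarrow> ('n cmat \<Rightarrow> 'n cmat) \<Rightarrow> ('n cmat \<Rightarrow> 'n cmat) \<Rightarrow> bool" where
  "biholomorphism U V \<phi> \<psi> \<longleftrightarrow>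
     open U \<and> open V \<and> homeomorphism U V \<phi> \<psi> \<and> holomorphic_map U \<phi> \<and> holomorphic_map V \<psi>"

text \<open>
  Embedded complex analytic submanifolds of complex dimension \<open>d\<close>, by slice charts: near each of
  its points \<open>S\<close> is carried by a biholomorphic chart of the ambient space to a coordinate
  subspace of dimension \<open>d\<close>. The set \<open>I\<close> consists of the positions of the free coordinates.
\<close>

definition complex_submanifold_dim :: "nat \<Rightarrow> 'n::finite cmat set \<Rightarrow> bool" where
  "complex_submanifold_dim d S \<longleftrightarrow>
     (\<forall>p\<in>S. \<exists>U V \<phi> \<psi> (I :: ('n \<times> 'n) set).
        p \<in> U \<and> biholomorphism U V \<phi> \<psi> \<and> card I = d \<and>
        \<phi> ` (U \<inter> S) = V \<inter> {A. \<forall>i j. (i, j) \<notin> I \<longrightarrow> A $ i $ j = 0})"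

definition complex_submanifold :: "'n::finite cmat set \<Rightarrow> bool" where
  "complex_submanifold S \<longleftrightarrow> (\<exists>d. complex_submanifold_dim d S)"

end

theory Submission
  imports Defs
begin

text \<open>
  Let \<open>X = Ma\<close>. For \<open>b\<close> in the \<open>\<L>\<close>-class \<open>L\<close> of \<open>a\<close> one has \<open>Mb = X\<close>, so \<open>L \<subseteq> X\<close>. Regularity provides an
  idempotent \<open>e\<close> with \<open>Me = Ma\<close>, which makes \<open>X = {b \<in> M. be = b}\<close> algebraic and \<open>L\<close> relatively
  open in \<open>X\<close> (\<open>L_class_open_in_left_ideal\<close>). As the image of \<open>M\<close> under a linear map, \<open>X\<close> is
  irreducible.

  An irreducible algebraic set is a submanifold near its generic points. Adjoin the matrix entries
  one at a time: either the new entry is algebraically independent of the previous ones on \<open>X\<close>, or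
  it satisfies a polynomial relation over them, and then a relation \<open>P\<close> of minimal degree
  has a leading coefficient and, the characteristic being \<open>0\<close>, a partial derivative that do not
  vanish identically on \<open>X\<close>. Let \<open>s\<close> be the product of all these leading coefficients and
  derivatives. Where \<open>s \<noteq> 0\<close>, the relations cut out exactly \<open>X\<close> and their Jacobian matrix in the
  dependent entries is triangular with nonzero diagonal (\<open>generic_system_exists\<close>). By
  the inverse function theorem the map that replaces every dependent entry by its relation
  is a slice chart for \<open>X\<close> (\<open>generic_slice_chart\<close>), and its dimension is the number of independent
  entries, the same at all points.

  It remains to move an arbitrary point \<open>b\<close> of \<open>L\<close> to a generic one. The polynomials \<open>det g\<close> and
  \<open>s (gb)\<close> in \<open>g\<close> do not vanish identically on \<open>M\<close>, the latter because \<open>Mb = X\<close>; as \<open>M\<close> is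
  irreducible, neither does their product. Hence there is an invertible \<open>g \<in> M\<close> with \<open>s (gb) \<noteq> 0\<close>.
  By regularity \<open>g\<inverse> \<in> M\<close>, so left multiplication by \<open>g\<close> is a linear automorphism of the ambient
  space that preserves \<open>L\<close> and pulls the chart at \<open>gb\<close> back to \<open>b\<close>. The
  \<open>\<R>\<close>-classes are the transposes of the \<open>\<L>\<close>-classes of the transposed monoid.
\<close>

section \<open>Polynomial functions of some of the matrix entries\<close>

definition entry :: "'n \<times> 'n \<Rightarrow> 'n::finite cmat \<Rightarrow> complex" where
  "entry k A = A $ fst k $ snd k"

text \<open>
  The polynomial functions of the entries with positions in \<open>S\<close>. Keeping track of \<open>S\<close> allows the entries
  to be adjoined one at a time; the inductive form turns each closure property and each statement
  about derivatives into a rule induction.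
\<close>

inductive_set poly_in :: "('n \<times> 'n) set \<Rightarrow> ('n::finite cmat \<Rightarrow> complex) set" for S where
  const: "(\<lambda>A. c) \<in> poly_in S"
| entry: "k \<in> S \<Longrightarrow> entry k \<in> poly_in S"
| add: "p \<in> poly_in S \<Longrightarrow> q \<in> poly_in S \<Longrightarrow> (\<lambda>A. p A + q A) \<in> poly_in S"
| mult: "p \<in> poly_in S \<Longrightarrow> q \<in> poly_in S \<Longrightarrow> (\<lambda>A. p A * q A) \<in> poly_in S"

lemma poly_in_mono:
  assumes "p \<in> poly_in S" "S \<subseteq> T"
  shows "p \<in> poly_in T"
  using assms by (induction rule: poly_in.induct) (auto intro: poly_in.intros)

lemma poly_in_sum:
  assumes "\<And>i. i \<in> I \<Longrightarrow> f i \<in> poly_in S"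
  shows "(\<lambda>A. \<Sum>i\<in>I. f i A) \<in> poly_in S"
  using assms by (induction I rule: infinite_finite_induct) (auto intro: poly_in.intros)

lemma poly_in_prod:
  assumes "\<And>i. i \<in> I \<Longrightarrow> f i \<in> poly_in S"
  shows "(\<lambda>A. \<Prod>i\<in>I. f i A) \<in> poly_in S"
  using assms by (induction I rule: infinite_finite_induct) (auto intro: poly_in.intros)

lemma poly_in_power: "p \<in> poly_in S \<Longrightarrow> (\<lambda>A. p A ^ m) \<in> poly_in S"
  by (induction m) (auto intro: poly_in.intros)

lemma poly_in_uminus: "p \<in> poly_in S \<Longrightarrow> (\<lambda>A. - p A) \<in> poly_in S"
  using poly_in.mult[OF poly_in.const[of "-1"], of p S] by simp

lemma poly_in_nth: "(\<lambda>A. A $ i $ j) \<in> poly_in UNIV"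
  using poly_in.entry[of "(i, j)" UNIV] by (simp add: entry_def[abs_def])

lemma poly_in_subst:
  assumes "p \<in> poly_in UNIV" and "\<And>i j. (\<lambda>A. F A $ i $ j) \<in> poly_in UNIV"
  shows "(\<lambda>A. p (F A)) \<in> poly_in UNIV"
  using assms(1)
proof (induction rule: poly_in.induct)
  case (entry k)
  then show ?case using assms(2)[of "fst k" "snd k"] by (simp add: entry_def)
qed (auto intro: poly_in.intros)

lemma poly_in_mult_left: "(\<lambda>A. (g ** A) $ i $ j) \<in> poly_in UNIV"
  by (simp add: matrix_matrix_mult_def) (intro poly_in_sum poly_in.mult poly_in.const poly_in_nth)

lemma poly_in_mult_right: "(\<lambda>A. (A ** g) $ i $ j) \<in> poly_in UNIV"
  by (simp add: matrix_matrix_mult_def) (intro poly_in_sum poly_in.mult poly_in.const poly_in_nth)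

lemma poly_in_transpose: "(\<lambda>A. transpose A $ i $ j) \<in> poly_in UNIV"
  using poly_in_nth[of j i] by (simp add: transpose_def)

lemma poly_in_det: "det \<in> poly_in UNIV"
  unfolding det_def[abs_def]
  by (intro poly_in_sum poly_in.mult poly_in.const poly_in_prod poly_in_nth)

lemma polynomial_fun_add:
  assumes "polynomial_fun p" "polynomial_fun q"
  shows "polynomial_fun (\<lambda>A. p A + q A)"
proof -
  obtain E c where E: "finite E"
    "\<And>A. p A = (\<Sum>e\<in>E. c e * (\<Prod>i\<in>UNIV. \<Prod>j\<in>UNIV. (A $ i $ j) ^ e i j))"
    using assms(1) unfolding polynomial_fun_def by auto
  obtain F d where F: "finite F"
    "\<And>A. q A = (\<Sum>e\<in>F. d e * (\<Prod>i\<in>UNIV. \<Prod>j\<in>UNIV. (A $ i $ j) ^ e i j))"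
    using assms(2) unfolding polynomial_fun_def by auto
  have pE: "p A = (\<Sum>e\<in>E \<union> F. (if e \<in> E then c e else 0) * (\<Prod>i\<in>UNIV. \<Prod>j\<in>UNIV. (A $ i $ j) ^ e i j))" for A
    unfolding E(2) using E(1) F(1) by (intro sum.mono_neutral_cong_left) auto
  have qF: "q A = (\<Sum>e\<in>E \<union> F. (if e \<in> F then d e else 0) * (\<Prod>i\<in>UNIV. \<Prod>j\<in>UNIV. (A $ i $ j) ^ e i j))" for A
    unfolding F(2) using E(1) F(1) by (intro sum.mono_neutral_cong_left) auto
  show ?thesis
    unfolding polynomial_fun_def
    by (rule exI[of _ "E \<union> F"],
        rule exI[of _ "\<lambda>e. (if e \<in> E then c e else 0) + (if e \<in> F then d e else 0)"])
       (use E(1) F(1) in \<open>simp only: pE qF finite_Un distrib_right sum.distrib simp_thms\<close>)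
qed

lemma polynomial_fun_monomial:
  "polynomial_fun (\<lambda>A. c * (\<Prod>i\<in>UNIV. \<Prod>j\<in>UNIV. (A $ i $ j) ^ e i j))"
  unfolding polynomial_fun_def by (rule exI[of _ "{e}"], rule exI[of _ "\<lambda>_. c"]) simp

lemma polynomial_fun_sum:
  assumes "\<And>i. i \<in> I \<Longrightarrow> polynomial_fun (f i)"
  shows "polynomial_fun (\<lambda>A. \<Sum>i\<in>I. f i A)"
  using assms
proof (induction I rule: infinite_finite_induct)
  case (insert x F)
  then show ?case by (simp add: polynomial_fun_add)
qed (use polynomial_fun_monomial[of 0] in simp_all)

lemma polynomial_fun_mult:
  assumes "polynomial_fun p" "polynomial_fun q"
  shows "polynomial_fun (\<lambda>A. p A * q A)"
proof -
  obtain E c where E: "\<And>A. p A = (\<Sum>e\<in>E. c e * (\<Prod>i\<in>UNIV. \<Prod>j\<in>UNIV. (A $ i $ j) ^ e i j))"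
    using assms(1) unfolding polynomial_fun_def by auto
  obtain F d where F: "\<And>A. q A = (\<Sum>e\<in>F. d e * (\<Prod>i\<in>UNIV. \<Prod>j\<in>UNIV. (A $ i $ j) ^ e i j))"
    using assms(2) unfolding polynomial_fun_def by auto
  have "p A * q A = (\<Sum>e\<in>E. \<Sum>f\<in>F. (c e * d f) * (\<Prod>i\<in>UNIV. \<Prod>j\<in>UNIV. (A $ i $ j) ^ (e i j + f i j)))" for A
    unfolding E F sum_product by (simp add: power_add prod.distrib mult_ac)
  then show ?thesis
    by (simp only:) (intro polynomial_fun_sum polynomial_fun_monomial)
qed

lemma polynomial_fun_iff: "polynomial_fun p \<longleftrightarrow> p \<in> poly_in UNIV"
proof
  assume "polynomial_fun p"
  then obtain E c where "p = (\<lambda>A. \<Sum>e\<in>E. c e * (\<Prod>i\<in>UNIV. \<Prod>j\<in>UNIV. (A $ i $ j) ^ e i j))"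
    unfolding polynomial_fun_def by auto
  then show "p \<in> poly_in UNIV"
    by (simp only:) (intro poly_in_sum poly_in.mult poly_in.const poly_in_prod poly_in_power poly_in_nth)
next
  assume "p \<in> poly_in UNIV"
  then show "polynomial_fun p"
  proof (induction rule: poly_in.induct)
    case (const c)
    show ?case using polynomial_fun_monomial[of c "\<lambda>i j. 0"] by simp
  next
    case (entry k)
    have "(\<Prod>i\<in>UNIV. \<Prod>j\<in>UNIV. (A $ i $ j) ^ (if (i, j) = k then 1 else 0)) = entry k A" for A :: "'a cmat"
    proof -
      have "(\<Prod>i\<in>UNIV. \<Prod>j\<in>UNIV. (A $ i $ j) ^ (if (i, j) = k then 1 else 0))
          = (\<Prod>l\<in>UNIV. if l = k then entry l A else 1)"
        unfolding prod.cartesian_product UNIV_Times_UNIV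
        by (intro prod.cong) (auto simp: entry_def)
      then show ?thesis by simp
    qed
    then show ?case
      using polynomial_fun_monomial[of 1 "\<lambda>i j. if (i, j) = k then 1 else 0"] by simp
  qed (auto intro: polynomial_fun_add polynomial_fun_mult)
qed

section \<open>Derivatives of polynomial functions\<close>

lemma entry_has_derivative: "(entry k has_derivative entry k) (at A)"
  unfolding entry_def[abs_def]
  by (intro bounded_linear_imp_has_derivative bounded_linear_compose[OF bounded_linear_vec_nth] bounded_linear_vec_nth)

text \<open>
  The facts about the Frechet derivative that the charts need: it is complex linear, it depends
  continuously on the base point (so that the inverse function theorem applies), and it ignores the
  entries on which the polynomial does not depend (so that Jacobian matrices become triangular).
\<close>

lemma poly_in_derivative:
  assumes "p \<in> poly_in S"
  shows poly_in_has_derivative: "(p has_derivative frechet_derivative p (at A)) (at A)"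
    and poly_in_derivative_scale:
      "frechet_derivative p (at A) (map_matrix ((*) c) v) = c * frechet_derivative p (at A) v"
    and poly_in_derivative_continuous: "continuous_on UNIV (\<lambda>A. frechet_derivative p (at A) v)"
    and poly_in_derivative_eq_0:
      "(\<And>k. k \<in> S \<Longrightarrow> entry k v = 0) \<Longrightarrow> frechet_derivative p (at A) v = 0"
proof -
  have "\<exists>D. (\<forall>A. (p has_derivative D A) (at A)) \<and>
    (\<forall>A (c::complex) v. D A (map_matrix ((*) c) v) = c * D A v) \<and>
    (\<forall>v. continuous_on UNIV (\<lambda>A. D A v)) \<and>
    (\<forall>A v. (\<forall>k\<in>S. entry k v = 0) \<longrightarrow> D A v = 0)"
    using assms
  proof (induction rule: poly_in.induct)
    case (const c)
    show ?case by (rule exI[of _ "\<lambda>A v. 0"]) auto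
  next
    case (entry k)
    show ?case
    proof (intro exI[of _ "\<lambda>A. entry k"] conjI allI impI)
      show "continuous_on UNIV (\<lambda>A. entry k v)" for v :: "'a cmat"
        by (rule continuous_on_const)
    qed (use entry in \<open>auto simp: entry_def intro: entry_has_derivative[unfolded entry_def]\<close>)
  next
    case (add p q)
    from add.IH(1) obtain D where D: "\<forall>A. (p has_derivative D A) (at A)"
      "\<forall>A (c::complex) v. D A (map_matrix ((*) c) v) = c * D A v"
      "\<forall>v. continuous_on UNIV (\<lambda>A. D A v)" "\<forall>A v. (\<forall>k\<in>S. entry k v = 0) \<longrightarrow> D A v = 0"
      by (elim exE conjE) (rule that)
    from add.IH(2) obtain D' where D': "\<forall>A. (q has_derivative D' A) (at A)"
      "\<forall>A (c::complex) v. D' A (map_matrix ((*) c) v) = c * D' A v"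
      "\<forall>v. continuous_on UNIV (\<lambda>A. D' A v)" "\<forall>A v. (\<forall>k\<in>S. entry k v = 0) \<longrightarrow> D' A v = 0"
      by (elim exE conjE) (rule that)
    show ?case
    proof (intro exI[of _ "\<lambda>A v. D A v + D' A v"] conjI allI impI)
      show "((\<lambda>A. p A + q A) has_derivative (\<lambda>v. D A v + D' A v)) (at A)" for A
        by (intro has_derivative_add D(1)[rule_format] D'(1)[rule_format])
      show "continuous_on UNIV (\<lambda>A. D A v + D' A v)" for v
        by (intro continuous_on_add D(3)[rule_format] D'(3)[rule_format])
    qed (simp_all add: D(2)[rule_format] D'(2)[rule_format] D(4)[rule_format] D'(4)[rule_format] distrib_left mult_ac)
  next
    case (mult p q)
    from mult.IH(1) obtain D where D: "\<forall>A. (p has_derivative D A) (at A)"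
      "\<forall>A (c::complex) v. D A (map_matrix ((*) c) v) = c * D A v"
      "\<forall>v. continuous_on UNIV (\<lambda>A. D A v)" "\<forall>A v. (\<forall>k\<in>S. entry k v = 0) \<longrightarrow> D A v = 0"
      by (elim exE conjE) (rule that)
    from mult.IH(2) obtain D' where D': "\<forall>A. (q has_derivative D' A) (at A)"
      "\<forall>A (c::complex) v. D' A (map_matrix ((*) c) v) = c * D' A v"
      "\<forall>v. continuous_on UNIV (\<lambda>A. D' A v)" "\<forall>A v. (\<forall>k\<in>S. entry k v = 0) \<longrightarrow> D' A v = 0"
      by (elim exE conjE) (rule that)
    have cont: "continuous_on UNIV p" "continuous_on UNIV q"
      by (intro continuous_at_imp_continuous_on ballI has_derivative_continuous[OF D(1)[rule_format]]
          has_derivative_continuous[OF D'(1)[rule_format]])+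
    show ?case
    proof (intro exI[of _ "\<lambda>A v. p A * D' A v + D A v * q A"] conjI allI impI)
      show "((\<lambda>A. p A * q A) has_derivative (\<lambda>v. p A * D' A v + D A v * q A)) (at A)" for A
        by (intro has_derivative_mult D(1)[rule_format] D'(1)[rule_format])
      show "continuous_on UNIV (\<lambda>A. p A * D' A v + D A v * q A)" for v
        by (intro continuous_on_add continuous_on_mult D(3)[rule_format] D'(3)[rule_format] cont)
    qed (simp_all add: D(2)[rule_format] D'(2)[rule_format] D(4)[rule_format] D'(4)[rule_format] distrib_left mult_ac)
  qed
  then obtain D where D: "\<forall>A. (p has_derivative D A) (at A)"
      "\<forall>A (c::complex) v. D A (map_matrix ((*) c) v) = c * D A v"
      "\<forall>v. continuous_on UNIV (\<lambda>A. D A v)" "\<forall>A v. (\<forall>k\<in>S. entry k v = 0) \<longrightarrow> D A v = 0"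
    by (elim exE conjE) (rule that)
  have eq: "frechet_derivative p (at A) = D A" for A
    by (rule frechet_derivative_at[symmetric, OF D(1)[rule_format]])
  show "(p has_derivative frechet_derivative p (at A)) (at A)"
    unfolding eq by (rule D(1)[rule_format])
  show "frechet_derivative p (at A) (map_matrix ((*) c) v) = c * frechet_derivative p (at A) v"
    unfolding eq by (rule D(2)[rule_format])
  show "continuous_on UNIV (\<lambda>A. frechet_derivative p (at A) v)"
    unfolding eq by (rule D(3)[rule_format])
  show "(\<And>k. k \<in> S \<Longrightarrow> entry k v = 0) \<Longrightarrow> frechet_derivative p (at A) v = 0"
    unfolding eq by (rule D(4)[rule_format])
qed

lemma poly_in_continuous: "p \<in> poly_in S \<Longrightarrow> continuous_on UNIV p"
  by (meson continuous_at_imp_continuous_on has_derivative_continuous poly_in_has_derivative)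

section \<open>Polynomials in one further entry\<close>

text \<open>
  The polynomials of degree less than \<open>m\<close> in the entry at position \<open>k\<close>, with coefficients that are
  polynomials in the entries in \<open>S\<close>. The recursion splits off the leading term, because the
  elimination below works by cancelling leading terms.
\<close>

primrec polys_below :: "'n \<times> 'n \<Rightarrow> ('n \<times> 'n) set \<Rightarrow> nat \<Rightarrow> ('n::finite cmat \<Rightarrow> complex) set" where
  "polys_below k S 0 = {\<lambda>A. 0}"
| "polys_below k S (Suc m) =
     {\<lambda>A. q A + c A * entry k A ^ m | q c. q \<in> polys_below k S m \<and> c \<in> poly_in S}"

lemma polys_below_SucI:
  "q \<in> polys_below k S m \<Longrightarrow> c \<in> poly_in S \<Longrightarrow> (\<lambda>A. q A + c A * entry k A ^ m) \<in> polys_below k S (Suc m)"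
  by auto

lemma polys_below_SucE:
  assumes "p \<in> polys_below k S (Suc m)"
  obtains q c where "q \<in> polys_below k S m" "c \<in> poly_in S" "p = (\<lambda>A. q A + c A * entry k A ^ m)"
  using assms by auto

lemma polys_below_Suc: "q \<in> polys_below k S m \<Longrightarrow> q \<in> polys_below k S (Suc m)"
  using polys_below_SucI[OF _ poly_in.const[of 0], of q k S m] by simp

lemma polys_below_mono: "m \<le> n \<Longrightarrow> q \<in> polys_below k S m \<Longrightarrow> q \<in> polys_below k S n"
  by (induction rule: dec_induct) (auto dest: polys_below_Suc simp del: polys_below.simps)

lemma polys_below_add:
  "p \<in> polys_below k S m \<Longrightarrow> q \<in> polys_below k S m \<Longrightarrow> (\<lambda>A. p A + q A) \<in> polys_below k S m"
proof (induction m arbitrary: p q)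
  case (Suc m)
  obtain p' c where p: "p' \<in> polys_below k S m" "c \<in> poly_in S" "p = (\<lambda>A. p' A + c A * entry k A ^ m)"
    by (rule polys_below_SucE[OF Suc.prems(1)])
  obtain q' d where q: "q' \<in> polys_below k S m" "d \<in> poly_in S" "q = (\<lambda>A. q' A + d A * entry k A ^ m)"
    by (rule polys_below_SucE[OF Suc.prems(2)])
  show ?case
    using polys_below_SucI[OF Suc.IH[OF p(1) q(1)] poly_in.add[OF p(2) q(2)]] p(3) q(3)
    by (simp add: algebra_simps del: polys_below.simps)
qed auto

lemma polys_below_smult:
  "c \<in> poly_in S \<Longrightarrow> q \<in> polys_below k S m \<Longrightarrow> (\<lambda>A. c A * q A) \<in> polys_below k S m"
proof (induction m arbitrary: q)
  case (Suc m)
  obtain q' d where q: "q' \<in> polys_below k S m" "d \<in> poly_in S" "q = (\<lambda>A. q' A + d A * entry k A ^ m)"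
    by (rule polys_below_SucE[OF Suc.prems(2)])
  show ?case
    using polys_below_SucI[OF Suc.IH[OF Suc.prems(1) q(1)] poly_in.mult[OF Suc.prems(1) q(2)]] q(3)
    by (simp add: algebra_simps del: polys_below.simps)
qed auto

lemma polys_below_shift:
  "q \<in> polys_below k S m \<Longrightarrow> (\<lambda>A. entry k A ^ i * q A) \<in> polys_below k S (m + i)"
proof (induction m arbitrary: q)
  case 0
  then show ?case using polys_below_mono[of 0 i "\<lambda>A. 0" k S] by simp
next
  case (Suc m)
  obtain q' d where q: "q' \<in> polys_below k S m" "d \<in> poly_in S" "q = (\<lambda>A. q' A + d A * entry k A ^ m)"
    by (rule polys_below_SucE[OF Suc.prems])
  show ?case
    using polys_below_SucI[OF Suc.IH[OF q(1)] q(2)] q(3)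
    by (simp add: algebra_simps power_add del: polys_below.simps)
qed

lemma polys_below_mult:
  "p \<in> polys_below k S m \<Longrightarrow> q \<in> polys_below k S n \<Longrightarrow> (\<lambda>A. p A * q A) \<in> polys_below k S (m + n)"
proof (induction n arbitrary: q)
  case 0
  then show ?case using polys_below_mono[of 0 m "\<lambda>A. 0" k S] by simp
next
  case (Suc n)
  obtain q' d where q: "q' \<in> polys_below k S n" "d \<in> poly_in S" "q = (\<lambda>A. q' A + d A * entry k A ^ n)"
    by (rule polys_below_SucE[OF Suc.prems(2)])
  have "(\<lambda>A. p A * q' A + d A * (entry k A ^ n * p A)) \<in> polys_below k S (m + n)"
    by (intro polys_below_add Suc.IH Suc.prems(1) q(1) polys_below_smult q(2) polys_below_shift)
  then show ?case
    unfolding q(3) add_Suc_right by (intro polys_below_Suc) (simp add: algebra_simps)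
qed

lemma poly_in_insert:
  assumes "p \<in> poly_in (insert k S)"
  shows "\<exists>m. p \<in> polys_below k S m"
proof -
  have below_1: "c \<in> polys_below k S 1" if "c \<in> poly_in S" for c
    using polys_below_SucI[of "\<lambda>A. 0" k S 0, OF _ that] by simp
  show ?thesis
    using assms
  proof (induction rule: poly_in.induct)
    case (const c)
    show ?case using below_1 poly_in.const by blast
  next
    case (entry l)
    show ?case
    proof (cases "l = k")
      case True
      have "(\<lambda>A. 0) \<in> polys_below k S 1" by (rule below_1) (rule poly_in.const)
      from polys_below_SucI[OF this poly_in.const[of 1]] show ?thesis
        using True by (auto simp del: polys_below.simps)
    next
      case False
      then show ?thesis using below_1 poly_in.entry entry by blast
    qed
  next
    case (add p q)
    then obtain m n where "p \<in> polys_below k S m" "q \<in> polys_below k S n" by blast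
    then have "(\<lambda>A. p A + q A) \<in> polys_below k S (max m n)"
      by (intro polys_below_add) (auto intro: polys_below_mono[rotated])
    then show ?case by blast
  next
    case (mult p q)
    then show ?case using polys_below_mult by blast
  qed
qed

lemma polys_below_poly_in: "p \<in> polys_below k S m \<Longrightarrow> p \<in> poly_in (insert k S)"
proof (induction m arbitrary: p)
  case 0
  then show ?case using poly_in.const[of 0] by simp
next
  case (Suc m)
  obtain q c where q: "q \<in> polys_below k S m" "c \<in> poly_in S" "p = (\<lambda>A. q A + c A * entry k A ^ m)"
    by (rule polys_below_SucE[OF Suc.prems])
  show ?case unfolding q(3)
    by (intro poly_in.add poly_in.mult poly_in_power poly_in.entry Suc.IH q(1) poly_in_mono[OF q(2)]) auto
qed

lemma top_term_derivative:
  assumes q: "q \<in> poly_in T" and c: "c \<in> poly_in S" and v: "\<And>l. l \<in> S \<Longrightarrow> entry l v = 0"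
  shows "frechet_derivative (\<lambda>A. q A + c A * entry k A ^ m) (at A) v
       = frechet_derivative q (at A) v + of_nat m * c A * entry k A ^ (m - 1) * entry k v"
proof -
  have der: "((\<lambda>A. q A + c A * entry k A ^ m) has_derivative
      (\<lambda>v. frechet_derivative q (at A) v + (c A * (of_nat m * entry k v * entry k A ^ (m - 1))
          + frechet_derivative c (at A) v * entry k A ^ m))) (at A)"
    by (intro has_derivative_add has_derivative_mult has_derivative_power entry_has_derivative
        poly_in_has_derivative[OF q] poly_in_has_derivative[OF c])
  show ?thesis
    by (simp add: poly_in_derivative_eq_0[OF c v] frechet_derivative_at[OF der, symmetric])
qed

text \<open>
  In directions that leave the entries in \<open>S\<close> unchanged, the derivative is the partial derivative
  \<open>p'\<close> with respect to the entry at \<open>k\<close>, whose degree has dropped by one.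
\<close>

lemma polys_below_partial_derivative:
  assumes "p \<in> polys_below k S m"
  shows "\<exists>p'\<in>polys_below k S (m - 1). \<forall>A v. (\<forall>l\<in>S. entry l v = 0) \<longrightarrow>
           frechet_derivative p (at A) v = p' A * entry k v"
  using assms
proof (induction m arbitrary: p)
  case 0
  have "frechet_derivative p (at A) v = 0" for A v
    using 0 by (simp add: frechet_derivative_const)
  then show ?case by simp
next
  case (Suc m)
  obtain q c where q: "q \<in> polys_below k S m" "c \<in> poly_in S" "p = (\<lambda>A. q A + c A * entry k A ^ m)"
    by (rule polys_below_SucE[OF Suc.prems])
  obtain q' where q': "q' \<in> polys_below k S (m - 1)"
    "\<And>A v. (\<forall>l\<in>S. entry l v = 0) \<Longrightarrow> frechet_derivative q (at A) v = q' A * entry k v"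
    using Suc.IH[OF q(1)] by blast
  define p' where "p' = (\<lambda>A. q' A + of_nat m * c A * entry k A ^ (m - 1))"
  have "p' \<in> polys_below k S m"
  proof (cases m)
    case 0
    then show ?thesis using q'(1) by (simp add: p'_def)
  next
    case (Suc n)
    have "(\<lambda>A. of_nat m * c A) \<in> poly_in S" by (intro poly_in.mult poly_in.const q(2))
    then show ?thesis using polys_below_SucI[of q' k S n] q'(1) Suc
      by (simp add: p'_def del: polys_below.simps)
  qed
  moreover have "frechet_derivative p (at A) v = p' A * entry k v" if "\<forall>l\<in>S. entry l v = 0" for A v
    using top_term_derivative[OF polys_below_poly_in[OF q(1)] q(2)] that q'(2)[OF that]
    by (simp add: q(3) p'_def algebra_simps)
  ultimately show ?case by auto
qed

section \<open>Generic points of irreducible algebraic sets\<close>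

definition vanishes_on :: "('a \<Rightarrow> complex) \<Rightarrow> 'a set \<Rightarrow> bool" where
  "vanishes_on p X \<longleftrightarrow> (\<forall>x\<in>X. p x = 0)"

text \<open>
  Irreducibility in algebraic form: the vanishing ideal of \<open>X\<close> is prime. This version passes
  directly to images under polynomial maps.
\<close>

definition prime_on :: "'n::finite cmat set \<Rightarrow> bool" where
  "prime_on X \<longleftrightarrow> (\<forall>p\<in>poly_in UNIV. \<forall>q\<in>poly_in UNIV.
     vanishes_on (\<lambda>A. p A * q A) X \<longrightarrow> vanishes_on p X \<or> vanishes_on q X)"

lemma prime_onD:
  assumes "prime_on X" "p \<in> poly_in S" "q \<in> poly_in S" "\<not> vanishes_on p X" "\<not> vanishes_on q X"
  shows "\<not> vanishes_on (\<lambda>A. p A * q A) X"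
  using assms poly_in_mono[OF _ subset_UNIV] unfolding prime_on_def by blast

lemma irreducible_imp_prime_on:
  assumes "algebraic_set X" "irreducible_set X"
  shows "prime_on X"
  unfolding prime_on_def
proof (intro ballI impI)
  fix p q
  assume p: "p \<in> poly_in UNIV" and q: "q \<in> poly_in UNIV" and pq: "vanishes_on (\<lambda>A. p A * q A) X"
  have cut: "algebraic_set (X \<inter> {A. r A = 0})" if "r \<in> poly_in UNIV" for r
  proof -
    obtain P where "\<forall>p\<in>P. polynomial_fun p" "X = {A. \<forall>p\<in>P. p A = 0}"
      using assms(1) unfolding algebraic_set_def by blast
    then show ?thesis
      using that unfolding algebraic_set_def
      by (intro exI[of _ "insert r P"]) (auto simp: polynomial_fun_iff)
  qed
  have "X = X \<inter> {A. p A = 0} \<union> X \<inter> {A. q A = 0}"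
    using pq by (auto simp: vanishes_on_def)
  then have "\<not> (X \<inter> {A. p A = 0} \<subset> X \<and> X \<inter> {A. q A = 0} \<subset> X)"
    using assms(2) cut[OF p] cut[OF q] unfolding irreducible_set_def by blast
  then show "vanishes_on p X \<or> vanishes_on q X"
    by (auto simp: vanishes_on_def)
qed

lemma prime_on_image:
  assumes "prime_on X" "\<And>i j. (\<lambda>A. F A $ i $ j) \<in> poly_in UNIV"
  shows "prime_on (F ` X)"
  using assms(1) poly_in_subst[OF _ assms(2)] unfolding prime_on_def vanishes_on_def
  by (simp add: ball_simps)

text \<open>
  Local equations for \<open>X\<close>, projected to the entries in \<open>S\<close>, on the open set \<open>s \<noteq> 0\<close>. The entries in
  \<open>T\<close> are algebraically dependent on the remaining ones, and \<open>P k\<close> is the relation for the entry at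
  \<open>k \<in> T\<close>. The fifth clause says that the relations define \<open>X\<close> where \<open>s\<close> does not vanish: their zeros
  are zeros of the whole vanishing ideal. The last one is the Jacobian criterion: a nonzero
  direction that changes only the entries in \<open>T\<close> is not annihilated by the derivatives of all the
  relations.
\<close>

definition generic_system ::
  "'n::finite cmat set \<Rightarrow> ('n \<times> 'n) set \<Rightarrow> ('n \<times> 'n) set \<Rightarrow> ('n \<times> 'n \<Rightarrow> 'n cmat \<Rightarrow> complex)
     \<Rightarrow> ('n cmat \<Rightarrow> complex) \<Rightarrow> bool" where
  "generic_system X S T P s \<longleftrightarrow>
    T \<subseteq> S \<and> s \<in> poly_in S \<and> \<not> vanishes_on s X \<and>
    (\<forall>k\<in>T. P k \<in> poly_in S \<and> vanishes_on (P k) X) \<and>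
    (\<forall>A q. s A \<noteq> 0 \<longrightarrow> (\<forall>k\<in>T. P k A = 0) \<longrightarrow> q \<in> poly_in S \<longrightarrow> vanishes_on q X \<longrightarrow> q A = 0) \<and>
    (\<forall>A v. s A \<noteq> 0 \<longrightarrow> (\<forall>k\<in>S - T. entry k v = 0) \<longrightarrow>
       (\<forall>k\<in>T. frechet_derivative (P k) (at A) v = 0) \<longrightarrow> (\<forall>k\<in>S. entry k v = 0))"

text \<open>
  The induction adjoins the entry at \<open>k\<close> to those in \<open>S\<close>. If every polynomial in this entry that vanishes
  on \<open>X\<close> has its leading coefficient in the ideal of \<open>X\<close>, then a polynomial vanishing on \<open>X\<close> has all its
  coefficients in the ideal, and the old system still works. Otherwise let \<open>R\<close> be a counterexample
  of minimal degree \<open>d\<close>, with leading coefficient \<open>c\<close>. Where \<open>c \<noteq> 0\<close>, division by \<open>R\<close>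
  reduces every member of the ideal to degree below \<open>d\<close>, where minimality forces all coefficients into
  the ideal. The partial derivative \<open>R'\<close> has degree \<open>d - 1\<close> and leading coefficient \<open>d c\<close>, so by
  minimality it is not in the ideal. Multiplying \<open>s\<close> by \<open>c\<close> and \<open>R'\<close> keeps it nonzero on \<open>X\<close>, since
  the ideal is prime.
\<close>

lemma generic_system_exists:
  fixes X :: "'n::finite cmat set"
  assumes prime: "prime_on X" and ne: "X \<noteq> {}" and fin: "finite S"
  shows "\<exists>T P s. generic_system X S T P s"
  using fin
proof (induction S)
  case empty
  obtain x where x: "x \<in> X" using ne by blast
  have const: "p A = p x" if "p \<in> poly_in {}" for p and A :: "'n cmat"
    using that by (induction rule: poly_in.induct) auto
  have "q A = 0" if "q \<in> poly_in {}" "vanishes_on q X" for q and A :: "'n cmat"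
    unfolding const[OF that(1), of A] using that(2) x by (simp add: vanishes_on_def)
  moreover have "\<not> vanishes_on (\<lambda>_. 1) X" using x by (auto simp: vanishes_on_def)
  ultimately have "generic_system X {} {} (\<lambda>_ _. 0) (\<lambda>_. 1)"
    unfolding generic_system_def using poly_in.const by simp
  then show ?case by blast
next
  case (insert k S)
  obtain T P s where IH: "generic_system X S T P s"
    using insert.IH by blast
  have T: "T \<subseteq> S" and s: "s \<in> poly_in S" "\<not> vanishes_on s X"
    and P: "\<And>l. l \<in> T \<Longrightarrow> P l \<in> poly_in S" "\<And>l. l \<in> T \<Longrightarrow> vanishes_on (P l) X"
    and ideal: "\<And>A q. \<lbrakk>s A \<noteq> 0; \<forall>l\<in>T. P l A = 0; q \<in> poly_in S; vanishes_on q X\<rbrakk> \<Longrightarrow> q A = 0"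
    and jac: "\<And>A v. \<lbrakk>s A \<noteq> 0; \<forall>l\<in>S - T. entry l v = 0;
       \<forall>l\<in>T. frechet_derivative (P l) (at A) v = 0\<rbrakk> \<Longrightarrow> \<forall>l\<in>S. entry l v = 0"
    using IH unfolding generic_system_def by simp_all
  have up: "p \<in> poly_in (insert k S)" if "p \<in> poly_in S" for p
    using that by (rule poly_in_mono) auto
  define rel where "rel d \<longleftrightarrow> (\<exists>q\<in>polys_below k S d. \<exists>c\<in>poly_in S.
      \<not> vanishes_on c X \<and> vanishes_on (\<lambda>A. q A + c A * entry k A ^ d) X)" for d
  show ?case
  proof (cases "\<exists>d. rel d")
    case False
    have *: "q A = 0" if "s A \<noteq> 0" "\<forall>l\<in>T. P l A = 0" "q \<in> polys_below k S m" "vanishes_on q X" for A q m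
      using that(3,4)
    proof (induction m arbitrary: q)
      case (Suc m)
      obtain q' c where q: "q' \<in> polys_below k S m" "c \<in> poly_in S" "q = (\<lambda>A. q' A + c A * entry k A ^ m)"
        by (rule polys_below_SucE[OF Suc.prems(1)])
      have c: "vanishes_on c X"
        using False q Suc.prems(2) unfolding rel_def by blast
      then have "vanishes_on q' X"
        using Suc.prems(2) by (simp add: q(3) vanishes_on_def)
      then show ?case
        using Suc.IH[OF q(1)] ideal[OF that(1,2) q(2) c] by (simp add: q(3))
    qed simp
    show ?thesis
      unfolding generic_system_def
    proof (intro exI[of _ T] exI[of _ P] exI[of _ s] conjI allI impI ballI)
      show "q A = 0" if "s A \<noteq> 0" "\<forall>l\<in>T. P l A = 0" "q \<in> poly_in (insert k S)" "vanishes_on q X" for A q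
        using *[OF that(1,2)] poly_in_insert[OF that(3)] that(4) by blast
      show "entry l v = 0" if "s A \<noteq> 0" "\<forall>l\<in>insert k S - T. entry l v = 0"
        "\<forall>l\<in>T. frechet_derivative (P l) (at A) v = 0" "l \<in> insert k S" for A v l
        using jac[of A v] that T insert.hyps by blast
    qed (use T s P up in auto)
  next
    case True
    define d where "d = (LEAST d. rel d)"
    have "rel d" unfolding d_def using True by (rule LeastI_ex)
    then obtain p c where p: "p \<in> polys_below k S d" and c: "c \<in> poly_in S" "\<not> vanishes_on c X"
      and R: "vanishes_on (\<lambda>A. p A + c A * entry k A ^ d) X"
      unfolding rel_def by blast
    have minimal: "\<not> rel m" if "m < d" for m
      using that not_less_Least unfolding d_def by blast
    define R where "R = (\<lambda>A. p A + c A * entry k A ^ d)"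
    have R_in: "R \<in> poly_in (insert k S)"
      unfolding R_def using polys_below_SucI[OF p c(1)] by (rule polys_below_poly_in)
    have "d \<noteq> 0"
    proof
      assume "d = 0"
      then show False using p c(2) R by (simp add: vanishes_on_def)
    qed
    then obtain d' where d': "d = Suc d'" using not0_implies_Suc by blast
    obtain p' where p': "p' \<in> polys_below k S d'"
      "\<And>A v. (\<forall>l\<in>S. entry l v = 0) \<Longrightarrow> frechet_derivative p (at A) v = p' A * entry k v"
      using polys_below_partial_derivative[OF p] d' by auto
    define R' where "R' = (\<lambda>A. p' A + (of_nat d * c A) * entry k A ^ d')"
    have dc: "(\<lambda>A. of_nat d * c A) \<in> poly_in S" by (intro poly_in.mult poly_in.const c(1))
    have R'_in: "R' \<in> poly_in (insert k S)"
      unfolding R'_def using polys_below_SucI[OF p'(1) dc] by (rule polys_below_poly_in)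
    have R'_der: "frechet_derivative R (at A) v = R' A * entry k v" if "\<forall>l\<in>S. entry l v = 0" for A v
    proof -
      have "frechet_derivative R (at A) v
          = frechet_derivative p (at A) v + of_nat d * c A * entry k A ^ (d - 1) * entry k v"
        unfolding R_def
        by (rule top_term_derivative[OF polys_below_poly_in[OF p] c(1)]) (use that in blast)
      then show ?thesis
        by (simp add: p'(2)[OF that] d' R'_def algebra_simps)
    qed
    have R'_nz: "\<not> vanishes_on R' X"
    proof
      assume "vanishes_on R' X"
      moreover have "\<not> vanishes_on (\<lambda>A. of_nat d * c A) X"
        using c(2) \<open>d \<noteq> 0\<close> by (auto simp: vanishes_on_def)
      ultimately have "rel d'"
        unfolding rel_def R'_def using p'(1) dc by blast
      then show False using minimal d' by simp
    qed
    define s' where "s' = (\<lambda>A. (s A * c A) * R' A)"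
    have "\<not> vanishes_on (\<lambda>A. s A * c A) X"
      using prime_onD[OF prime s(1) c(1) s(2) c(2)] .
    from prime_onD[OF prime up[OF poly_in.mult[OF s(1) c(1)]] R'_in this R'_nz]
    have s'_nz: "\<not> vanishes_on s' X" unfolding s'_def .
    have s'_in: "s' \<in> poly_in (insert k S)"
      unfolding s'_def by (intro poly_in.mult up s(1) c(1) R'_in)
    define P' where "P' = P(k := R)"
    have P'k: "P' k = R" by (simp add: P'_def)
    have P'l: "P' l = P l" if "l \<in> T" for l
      using that T insert.hyps by (auto simp: P'_def)
    have *: "q A = 0" if A: "s A \<noteq> 0" "c A \<noteq> 0" "\<forall>l\<in>T. P l A = 0" "R A = 0"
      and "q \<in> polys_below k S m" "vanishes_on q X" for A q m
      using that(5,6)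
    proof (induction m arbitrary: q)
      case (Suc m)
      obtain q' b where q: "q' \<in> polys_below k S m" "b \<in> poly_in S" "q = (\<lambda>A. q' A + b A * entry k A ^ m)"
        by (rule polys_below_SucE[OF Suc.prems(1)])
      show ?case
      proof (cases "vanishes_on b X")
        case True
        then have "vanishes_on q' X"
          using Suc.prems(2) by (simp add: q(3) vanishes_on_def)
        then show ?thesis
          using Suc.IH[OF q(1)] ideal[OF A(1,3) q(2) True] by (simp add: q(3))
      next
        case False
        then have "rel m"
          using q Suc.prems(2) unfolding rel_def by blast
        then have "d \<le> m" using minimal by (meson not_le)
        then obtain i where m: "m = d + i" using le_Suc_ex by blast
        \<comment> \<open>One step of the division: the leading terms of \<open>c q\<close> and \<open>b x\<^sup>i R\<close> agree, \<open>x\<close> being the new entry.\<close>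
        define r where "r = (\<lambda>A. c A * q' A + (- b A) * (entry k A ^ i * p A))"
        have "r \<in> polys_below k S m"
          unfolding r_def
          using polys_below_add[OF polys_below_smult[OF c(1) q(1)]
              polys_below_smult[OF poly_in_uminus[OF q(2)]]] polys_below_shift[OF p, of i]
          by (simp add: m)
        moreover have r: "r B = c B * q B - b B * entry k B ^ i * R B" for B
          by (simp add: r_def q(3) R_def m power_add algebra_simps)
        have "vanishes_on r X"
          using Suc.prems(2) R unfolding r R_def vanishes_on_def by simp
        ultimately have "r A = 0" using Suc.IH by blast
        then show ?thesis using r[of A] A(2,4) by simp
      qed
    qed simp
    show ?thesis
      unfolding generic_system_def
    proof (intro exI[of _ "insert k T"] exI[of _ P'] exI[of _ s'] conjI allI impI ballI)
      show "P' l \<in> poly_in (insert k S)" "vanishes_on (P' l) X" if "l \<in> insert k T" for l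
        using that P'k P'l[of l] P[of l] R R_in up by (auto simp: R_def)
      show "q A = 0" if "s' A \<noteq> 0" "\<forall>l\<in>insert k T. P' l A = 0" and q: "q \<in> poly_in (insert k S)" "vanishes_on q X" for A q
      proof -
        obtain m where "q \<in> polys_below k S m" using poly_in_insert[OF q(1)] by blast
        with *[of A q m] that(1,2) q(2) P'k P'l show ?thesis by (simp add: s'_def)
      qed
      show "entry l v = 0" if "s' A \<noteq> 0" "\<forall>l\<in>insert k S - insert k T. entry l v = 0"
        and der: "\<forall>l\<in>insert k T. frechet_derivative (P' l) (at A) v = 0" and l: "l \<in> insert k S" for A v l
      proof -
        have S: "\<forall>l\<in>S. entry l v = 0"
          using that(1,2) der P'l T insert.hyps by (intro jac[of A]) (auto simp: s'_def)
        then have "R' A * entry k v = 0"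
          using R'_der[of v A] der P'k by simp
        then show ?thesis using that(1) S l by (auto simp: s'_def)
      qed
    qed (use T s'_in s'_nz in auto)
  qed
qed

section \<open>Slice charts\<close>

definition slice_chart_at :: "nat \<Rightarrow> 'n::finite cmat set \<Rightarrow> 'n cmat \<Rightarrow> bool" where
  "slice_chart_at d S p \<longleftrightarrow>
     (\<exists>U V \<phi> \<psi> (I :: ('n \<times> 'n) set).
        p \<in> U \<and> biholomorphism U V \<phi> \<psi> \<and> card I = d \<and>
        \<phi> ` (U \<inter> S) = V \<inter> {A. \<forall>i j. (i, j) \<notin> I \<longrightarrow> A $ i $ j = 0})"

lemma complex_submanifold_iff: "complex_submanifold S \<longleftrightarrow> (\<exists>d. \<forall>p\<in>S. slice_chart_at d S p)"
  by (simp only: complex_submanifold_def complex_submanifold_dim_def slice_chart_at_def)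

text \<open>
  The inverse function theorem for polynomial maps. The local inverse is holomorphic because its
  derivative is the inverse of a complex linear map.
\<close>

lemma polynomial_local_biholomorphism:
  fixes P :: "'n \<times> 'n \<Rightarrow> 'n::finite cmat \<Rightarrow> complex"
  assumes P: "\<And>k. P k \<in> poly_in UNIV" and "open W" "p \<in> W"
    and inj: "\<And>v. (\<And>k. frechet_derivative (P k) (at p) v = 0) \<Longrightarrow> v = 0"
  obtains U V \<psi> where "p \<in> U" "U \<subseteq> W" "biholomorphism U V (\<lambda>A. \<chi> i j. P (i, j) A) \<psi>"
proof -
  define F where "F = (\<lambda>A. (\<chi> i j. P (i, j) A) :: 'n cmat)"
  define F' where "F' = (\<lambda>A v. (\<chi> i j. frechet_derivative (P (i, j)) (at A) v) :: 'n cmat)"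
  \<comment> \<open>Differentiating the matrix-valued map reduces to its entries by writing it as a sum of elementary matrices.\<close>
  define E where "E = (\<lambda>k z. (\<chi> i j. if (i, j) = k then z else 0) :: 'n cmat)"
  have E_sum: "(\<chi> i j. f (i, j)) = (\<Sum>k\<in>UNIV. E k (f k))" for f
    by (simp add: vec_eq_iff E_def)
  have bl_E: "bounded_linear (E k)" for k
    by (rule linear_conv_bounded_linear[THEN iffD1], rule linearI) (auto simp: E_def vec_eq_iff)
  have der: "(F has_derivative F' A) (at A)" for A
    unfolding F_def F'_def E_sum[of "\<lambda>k. P k A" for A]
      E_sum[of "\<lambda>k. frechet_derivative (P k) (at A) v" for v]
    by (intro has_derivative_sum bounded_linear.has_derivative[OF bl_E] poly_in_has_derivative[OF P])
  have F'_scale: "F' A (map_matrix ((*) c) v) = map_matrix ((*) c) (F' A v)" for A c v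
    by (simp add: F'_def vec_eq_iff poly_in_derivative_scale[OF P])
  have bl: "bounded_linear (F' A)" for A
    using der by (rule has_derivative_bounded_linear)
  have cont: "continuous_on W (\<lambda>A. Blinfun (F' A))"
  proof (rule continuous_on_blinfun_componentwise)
    fix v :: "'n cmat"
    have "continuous_on W (\<lambda>A. F' A v)"
      unfolding F'_def
      by (intro continuous_on_vec_lambda continuous_on_subset[OF poly_in_derivative_continuous[OF P]]) auto
    then show "continuous_on W (\<lambda>A. blinfun_apply (Blinfun (F' A)) v)"
      by (simp add: bounded_linear_Blinfun_apply[OF bl])
  qed
  have "inj (F' p)"
  proof (rule linear_injective_0[THEN iffD2])
    show "linear (F' p)" using bl by (rule bounded_linear.linear)
    show "\<forall>v. F' p v = 0 \<longrightarrow> v = 0"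
      using inj by (auto simp: F'_def vec_eq_iff)
  qed
  then obtain G where G: "linear G" "G \<circ> F' p = id"
    using linear_injective_left_inverse[OF bounded_linear.linear[OF bl]] by blast
  then have "bounded_linear G" by (simp add: linear_conv_bounded_linear)
  then have inv: "Blinfun G o\<^sub>L Blinfun (F' p) = id_blinfun"
    using G(2) by (intro blinfun_eqI) (simp add: bounded_linear_Blinfun_apply bl o_def fun_eq_iff)
  obtain U V \<psi> \<psi>' where U: "open U" "U \<subseteq> W" "p \<in> U" "open V" "F p \<in> V" "homeomorphism U V F \<psi>"
    and d\<psi>: "\<And>y. y \<in> V \<Longrightarrow> (\<psi> has_derivative (\<psi>' y)) (at y)"
    and \<psi>': "\<And>y. y \<in> V \<Longrightarrow> \<psi>' y = inv (blinfun_apply (Blinfun (F' (\<psi> y))))"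
    and bij: "\<And>y. y \<in> V \<Longrightarrow> bij (blinfun_apply (Blinfun (F' (\<psi> y))))"
    by (rule inverse_function_theorem[of W F "\<lambda>A. Blinfun (F' A)" p "Blinfun G"])
       (use assms(2,3) der cont inv in \<open>simp_all add: bounded_linear_Blinfun_apply bl\<close>)
  have "holomorphic_map U F"
    unfolding holomorphic_map_def using der F'_scale by blast
  moreover have "holomorphic_map V \<psi>"
    unfolding holomorphic_map_def
  proof (intro ballI exI conjI allI)
    fix y c X assume y: "y \<in> V"
    show "(\<psi> has_derivative (\<psi>' y)) (at y)" using d\<psi>[OF y] .
    have b: "bij (F' (\<psi> y))" and e: "\<psi>' y = inv (F' (\<psi> y))"
      using bij[OF y] \<psi>'[OF y] by (simp_all add: bounded_linear_Blinfun_apply bl)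
    have "F' (\<psi> y) (map_matrix ((*) c) (\<psi>' y X)) = map_matrix ((*) c) X"
      unfolding F'_scale e using b by (simp add: bij_is_surj surj_f_inv_f)
    then show "\<psi>' y (map_matrix ((*) c) X) = map_matrix ((*) c) (\<psi>' y X)"
      unfolding e using b by (metis bij_inv_eq_iff)
  qed
  ultimately have "biholomorphism U V F \<psi>"
    using U by (simp add: biholomorphism_def)
  then show thesis using that U(2,3) unfolding F_def by blast
qed

text \<open>
  The chart keeps the independent entries and replaces each dependent one by its relation. It is
  stated for a set \<open>S\<close> that coincides with \<open>X\<close> only near \<open>p\<close>, as a Green class does.
\<close>

lemma generic_slice_chart:
  assumes X: "algebraic_set X" and sys: "generic_system X UNIV T P s"
    and p: "p \<in> X" "s p \<noteq> 0" and W: "open W" "p \<in> W" "W \<inter> X = W \<inter> S"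
  shows "slice_chart_at (card (- T)) S p"
proof -
  have s: "s \<in> poly_in UNIV"
    and P: "\<And>k. k \<in> T \<Longrightarrow> P k \<in> poly_in UNIV" "\<And>k. k \<in> T \<Longrightarrow> vanishes_on (P k) X"
    and ideal: "\<And>A q. \<lbrakk>s A \<noteq> 0; \<forall>k\<in>T. P k A = 0; q \<in> poly_in UNIV; vanishes_on q X\<rbrakk> \<Longrightarrow> q A = 0"
    and jac: "\<And>A v. \<lbrakk>s A \<noteq> 0; \<forall>k\<in>- T. entry k v = 0;
       \<forall>k\<in>T. frechet_derivative (P k) (at A) v = 0\<rbrakk> \<Longrightarrow> \<forall>k. entry k v = 0"
    using sys unfolding generic_system_def by (simp_all add: Compl_eq_Diff_UNIV)
  obtain Q where Q: "\<forall>q\<in>Q. polynomial_fun q" "X = {A. \<forall>q\<in>Q. q A = 0}"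
    using X unfolding algebraic_set_def by blast
  have in_X: "A \<in> X" if "s A \<noteq> 0" "\<forall>k\<in>T. P k A = 0" for A
  proof -
    have "q A = 0" if "q \<in> Q" for q
    proof (rule ideal[OF \<open>s A \<noteq> 0\<close> \<open>\<forall>k\<in>T. P k A = 0\<close>])
      show "q \<in> poly_in UNIV" using Q(1) that polynomial_fun_iff by blast
      show "vanishes_on q X" using Q(2) that by (simp add: vanishes_on_def)
    qed
    then show ?thesis using Q(2) by blast
  qed
  define P' where "P' k = (if k \<in> T then P k else entry k)" for k
  define F where "F = (\<lambda>A. (\<chi> i j. P' (i, j) A) :: 'a cmat)"
  have "open {A. s A \<noteq> 0}"
    using poly_in_continuous[OF s] by (intro open_Collect_neq) auto
  then have W': "open (W \<inter> {A. s A \<noteq> 0})" "p \<in> W \<inter> {A. s A \<noteq> 0}" using W p by auto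
  have P': "P' k \<in> poly_in UNIV" for k
    using P(1) by (auto simp: P'_def intro: poly_in.entry)
  have P'_inj: "v = 0" if v: "\<And>k. frechet_derivative (P' k) (at p) v = 0" for v
  proof -
    have "\<forall>k. entry k v = 0"
    proof (rule jac[OF p(2)]; rule ballI)
      show "entry k v = 0" if "k \<in> - T" for k
        using v[of k] that frechet_derivative_at[OF entry_has_derivative[of k p]] by (simp add: P'_def)
      show "frechet_derivative (P k) (at p) v = 0" if "k \<in> T" for k
        using v[of k] that by (simp add: P'_def)
    qed
    then show ?thesis by (simp add: entry_def vec_eq_iff)
  qed
  obtain U V \<psi> where U: "p \<in> U" "U \<subseteq> W \<inter> {A. s A \<noteq> 0}" and bih: "biholomorphism U V F \<psi>"
    by (rule polynomial_local_biholomorphism[OF P' W' P'_inj]) (simp_all add: F_def)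
  have hom: "homeomorphism U V F \<psi>" using bih by (simp add: biholomorphism_def)
  have slice: "F A \<in> {B. \<forall>i j. (i, j) \<notin> - T \<longrightarrow> B $ i $ j = 0} \<longleftrightarrow> (\<forall>k\<in>T. P k A = 0)" for A
    by (auto simp: F_def P'_def)
  have "A \<in> S \<longleftrightarrow> (\<forall>k\<in>T. P k A = 0)" if "A \<in> U" for A
  proof -
    have "A \<in> S \<longleftrightarrow> A \<in> X" using that U(2) W(3) by blast
    also have "\<dots> \<longleftrightarrow> (\<forall>k\<in>T. P k A = 0)"
      using in_X[of A] P(2) that U(2) by (auto simp: vanishes_on_def)
    finally show ?thesis .
  qed
  moreover have "F ` U = V" using hom by (simp add: homeomorphism_def)
  ultimately have "F ` (U \<inter> S) = V \<inter> {B. \<forall>i j. (i, j) \<notin> - T \<longrightarrow> B $ i $ j = 0}"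
    using slice by blast
  then show ?thesis
    unfolding slice_chart_at_def using U(1) bih by blast
qed

text \<open>
  Slice charts can be pulled back along complex linear automorphisms of the ambient space. This
  serves both for left multiplication by a unit and for transposition.
\<close>

lemma slice_chart_at_linear_iso:
  fixes F G :: "'n::finite cmat \<Rightarrow> 'n cmat"
  assumes lin: "linear F" "linear G" and inv: "\<And>A. G (F A) = A" "\<And>A. F (G A) = A"
    and scale: "\<And>(c::complex) A. F (map_matrix ((*) c) A) = map_matrix ((*) c) (F A)"
      "\<And>(c::complex) A. G (map_matrix ((*) c) A) = map_matrix ((*) c) (G A)"
    and chart: "slice_chart_at d (F ` S) (F p)"
  shows "slice_chart_at d S p"
proof -
  obtain U V \<phi> \<psi> I where U: "F p \<in> U" and bih: "biholomorphism U V \<phi> \<psi>" and I: "card I = d"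
    and slice: "\<phi> ` (U \<inter> F ` S) = V \<inter> {A. \<forall>i j. (i, j) \<notin> I \<longrightarrow> A $ i $ j = 0}"
    using chart unfolding slice_chart_at_def by blast
  have b: "open U" "open V" "homeomorphism U V \<phi> \<psi>" "holomorphic_map U \<phi>" "holomorphic_map V \<psi>"
    using bih by (simp_all add: biholomorphism_def)
  have bl: "bounded_linear F" "bounded_linear G" using lin by (simp_all add: linear_conv_bounded_linear)
  have cont: "continuous_on T F" "continuous_on T G" for T
    using bl by (simp_all add: linear_continuous_on)
  have GU: "G ` U = F -` U" using inv by (auto simp: image_iff) (metis)
  have "open (G ` U)"
    unfolding GU using b(1) cont(1)[of UNIV] by (simp add: continuous_on_open_vimage)
  moreover have "homeomorphism (G ` U) V (\<phi> \<circ> F) (G \<circ> \<psi>)"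
  proof (rule homeomorphism_compose[OF _ b(3)])
    show "homeomorphism (G ` U) U F G"
      using cont inv by (intro homeomorphismI) auto
  qed
  moreover have "holomorphic_map (G ` U) (\<phi> \<circ> F)"
    unfolding holomorphic_map_def
  proof
    fix A assume "A \<in> G ` U"
    then have "F A \<in> U" using inv by auto
    then obtain D where D: "(\<phi> has_derivative D) (at (F A))"
      "\<And>(c::complex) X. D (map_matrix ((*) c) X) = map_matrix ((*) c) (D X)"
      using b(4) unfolding holomorphic_map_def by blast
    then show "\<exists>D. (\<phi> \<circ> F has_derivative D) (at A) \<and>
        (\<forall>(c::complex) X. D (map_matrix ((*) c) X) = map_matrix ((*) c) (D X))"
      using scale(1) diff_chain_at[OF bounded_linear_imp_has_derivative[OF bl(1)], of \<phi> D A]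
      by (intro exI[of _ "D \<circ> F"]) auto
  qed
  moreover have "holomorphic_map V (G \<circ> \<psi>)"
    unfolding holomorphic_map_def
  proof
    fix A assume "A \<in> V"
    then obtain D where D: "(\<psi> has_derivative D) (at A)"
      "\<And>(c::complex) X. D (map_matrix ((*) c) X) = map_matrix ((*) c) (D X)"
      using b(5) unfolding holomorphic_map_def by blast
    then show "\<exists>D. (G \<circ> \<psi> has_derivative D) (at A) \<and>
        (\<forall>(c::complex) X. D (map_matrix ((*) c) X) = map_matrix ((*) c) (D X))"
      using scale(2) diff_chain_at[OF D(1) bounded_linear_imp_has_derivative[OF bl(2)]]
      by (intro exI[of _ "G \<circ> D"]) auto
  qed
  ultimately have "biholomorphism (G ` U) V (\<phi> \<circ> F) (G \<circ> \<psi>)"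
    using b(2) by (simp add: biholomorphism_def)
  moreover have "(\<phi> \<circ> F) ` (G ` U \<inter> S) = \<phi> ` (U \<inter> F ` S)"
  proof -
    have "F ` (G ` U \<inter> S) = U \<inter> F ` S" unfolding GU by auto
    then show ?thesis by (metis image_comp)
  qed
  moreover have "p \<in> G ` U" using U GU by simp
  ultimately show ?thesis
    unfolding slice_chart_at_def using I slice
    by (intro exI[of _ "G ` U"] exI[of _ V] exI[of _ "\<phi> \<circ> F"] exI[of _ "G \<circ> \<psi>"] exI[of _ I]) simp
qed

section \<open>The Green classes\<close>

lemma L_class_iff:
  assumes "matrix_submonoid M"
  shows "b \<in> L_class M a \<longleftrightarrow> b \<in> M \<and> (\<exists>x\<in>M. a = x ** b) \<and> (\<exists>x\<in>M. b = x ** a)"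
proof -
  have one: "mat 1 \<in> M" and mul: "\<And>x y. x \<in> M \<Longrightarrow> y \<in> M \<Longrightarrow> x ** y \<in> M"
    using assms unfolding matrix_submonoid_def by auto
  have sub: "(\<lambda>m. m ** c) ` M \<subseteq> (\<lambda>m. m ** d) ` M \<longleftrightarrow> (\<exists>x\<in>M. c = x ** d)" for c d
  proof
    assume "(\<lambda>m. m ** c) ` M \<subseteq> (\<lambda>m. m ** d) ` M"
    then have "mat 1 ** c \<in> (\<lambda>m. m ** d) ` M" using one by blast
    then show "\<exists>x\<in>M. c = x ** d" by auto
  next
    assume "\<exists>x\<in>M. c = x ** d"
    then show "(\<lambda>m. m ** c) ` M \<subseteq> (\<lambda>m. m ** d) ` M"
      using mul by (auto simp: matrix_mul_assoc)
  qed
  have "(\<lambda>m. m ** b) ` M = (\<lambda>m. m ** a) ` M \<longleftrightarrow> (\<exists>x\<in>M. a = x ** b) \<and> (\<exists>x\<in>M. b = x ** a)"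
    unfolding set_eq_subset sub by blast
  then show ?thesis unfolding L_class_def by simp
qed

lemma L_class_mult_unit:
  assumes "matrix_submonoid M" "g \<in> M" "h \<in> M" "h ** g = mat 1" "b \<in> L_class M a"
  shows "g ** b \<in> L_class M a"
proof -
  have mul: "\<And>x y. x \<in> M \<Longrightarrow> y \<in> M \<Longrightarrow> x ** y \<in> M"
    using assms(1) unfolding matrix_submonoid_def by auto
  obtain x y where b: "b \<in> M" "x \<in> M" "y \<in> M" "a = x ** b" "b = y ** a"
    using assms(5) unfolding L_class_iff[OF assms(1)] by blast
  have "a = x ** (h ** g) ** b" using assms(4) b(4) by simp
  then have "a = (x ** h) ** (g ** b)" by (simp only: matrix_mul_assoc)
  moreover have "g ** b = (g ** y) ** a" using b(5) by (simp flip: matrix_mul_assoc)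
  ultimately show ?thesis
    unfolding L_class_iff[OF assms(1)] using mul assms(2,3) b(1-3) by metis
qed

lemma unit_inverse_in_regular_monoid:
  assumes "regular_monoid M" "g \<in> M" "det g \<noteq> 0"
  obtains h where "h \<in> M" "h ** g = mat 1" "g ** h = mat 1"
proof -
  obtain x where x: "x \<in> M" "g ** x ** g = g"
    using assms(1,2) unfolding regular_monoid_def by blast
  obtain k where k: "k ** g = mat 1"
    using assms(3) invertible_det_nz invertible_left_inverse by blast
  have "k ** (g ** x ** g) = mat 1" using x(2) k by simp
  then have "x ** g = mat 1" by (simp add: matrix_mul_assoc k)
  then show thesis using that x(1) matrix_left_right_inverse by blast
qed

text \<open>
  Write \<open>a = x b\<^sub>0\<close> and \<open>a = a y a\<close>, and let \<open>e = y a\<close>, an idempotent with \<open>ae = a\<close>. For \<open>b \<in> Ma\<close> the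
  element \<open>c = y x b\<close> of \<open>M\<close> satisfies \<open>ce = c\<close>, and it equals \<open>e\<close> at \<open>b = b\<^sub>0\<close>. So \<open>g = c + (1 - e)\<close>
  is invertible for \<open>b\<close> near \<open>b\<^sub>0\<close>, and \<open>ge = c\<close>. If \<open>z \<in> M\<close> is such that \<open>c z c = c\<close>, then cancelling
  \<open>g\<close> in \<open>g e z c = g e\<close> yields \<open>e = e z c \<in> Mb\<close>, hence \<open>a = ae \<in> Mb\<close>. Regularity of \<open>M\<close> thus supplies
  the inverse within \<open>M\<close>; invertibility of \<open>g\<close> among all matrices alone would not suffice.
\<close>

lemma L_class_open_in_left_ideal:
  fixes M :: "'a::finite cmat set"
  assumes mon: "matrix_submonoid M" and reg: "regular_monoid M" and a: "a \<in> M"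
    and b0: "b0 \<in> L_class M a"
  obtains W where "open W" "b0 \<in> W" "W \<inter> (\<lambda>m. m ** a) ` M = W \<inter> L_class M a"
proof -
  have mul: "\<And>x y. x \<in> M \<Longrightarrow> y \<in> M \<Longrightarrow> x ** y \<in> M"
    using mon unfolding matrix_submonoid_def by auto
  obtain y where y: "y \<in> M" "a ** y ** a = a"
    using reg a unfolding regular_monoid_def by blast
  obtain x where x: "x \<in> M" "a = x ** b0"
    using b0 unfolding L_class_iff[OF mon] by blast
  define e where "e = y ** a"
  have ae: "a ** e = a" unfolding e_def matrix_mul_assoc by (rule y(2))
  have "y ** (a ** e) = y ** a" by (simp only: ae)
  then have ee: "e ** e = e" by (simp only: e_def matrix_mul_assoc)
  define W where "W = {b. det ((y ** x) ** b + (mat 1 - e)) \<noteq> 0}"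
  have "(\<lambda>b. ((y ** x) ** b + (mat 1 - e)) $ i $ j) \<in> poly_in UNIV" for i j
    using poly_in.add[OF poly_in_mult_left poly_in.const, of "y ** x" i j "(mat 1 - e) $ i $ j"] by simp
  then have "(\<lambda>b. det ((y ** x) ** b + (mat 1 - e))) \<in> poly_in UNIV"
    by (rule poly_in_subst[OF poly_in_det, of "\<lambda>b. (y ** x) ** b + (mat 1 - e)"])
  then have open_W: "open W"
    unfolding W_def by (intro open_Collect_neq poly_in_continuous continuous_on_const)
  have b0_W: "b0 \<in> W"
  proof -
    have "(y ** x) ** b0 = e" by (simp only: e_def x(2) matrix_mul_assoc)
    then show ?thesis by (simp add: W_def)
  qed
  have W_L: "b \<in> L_class M a" if b: "b \<in> W" "b \<in> (\<lambda>m. m ** a) ` M" for b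
  proof -
    obtain m where m: "m \<in> M" "b = m ** a" using b(2) by blast
    have bM: "b \<in> M" using m a mul by blast
    define c where "c = (y ** x) ** b"
    have cM: "c \<in> M" unfolding c_def using mul x(1) y(1) bM by blast
    have "b ** e = m ** (a ** e)" by (simp only: m(2) matrix_mul_assoc)
    then have be: "b ** e = b" by (simp only: ae m(2))
    have "c ** e = (y ** x) ** (b ** e)" by (simp only: c_def matrix_mul_assoc)
    then have ce: "c ** e = c" by (simp only: be c_def)
    obtain z where z: "z \<in> M" "c ** z ** c = c"
      using reg cM unfolding regular_monoid_def by blast
    define g where "g = c + (mat 1 - e)"
    have ge: "g ** e = c"
    proof -
      have "(A + (B - C)) ** D = A ** D + (B ** D - C ** D)" for A B C D :: "'a cmat"
        by (simp add: matrix_matrix_mult_def vec_eq_iff sum.distrib sum_subtractf algebra_simps)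
      then show ?thesis by (simp add: g_def ce ee)
    qed
    obtain h where h: "h ** g = mat 1"
      using b(1) invertible_det_nz invertible_left_inverse unfolding W_def g_def c_def by blast
    have "(h ** g) ** e = h ** c"
      by (simp only: ge flip: matrix_mul_assoc)
    then have hc: "h ** c = e" by (simp add: h)
    have "(h ** c) ** z ** c = h ** (c ** z ** c)"
      by (simp only: matrix_mul_assoc)
    then have eq: "e = e ** z ** c" by (simp only: hc z(2))
    have "a = a ** e" using ae by simp
    also have "\<dots> = a ** (e ** z ** c)" by (rule arg_cong[OF eq])
    also have "\<dots> = (a ** e ** z ** (y ** x)) ** b"
      by (simp only: c_def matrix_mul_assoc)
    finally have "a = (a ** e ** z ** (y ** x)) ** b" .
    moreover have "a ** e ** z ** (y ** x) \<in> M"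
      unfolding e_def using mul a x(1) y(1) z(1) by simp
    ultimately have "\<exists>u\<in>M. a = u ** b" by (rule rev_bexI[rotated])
    moreover have "\<exists>u\<in>M. b = u ** a" using m by (intro bexI)
    ultimately show ?thesis
      unfolding L_class_iff[OF mon] using bM by (intro conjI)
  qed
  have "W \<inter> (\<lambda>m. m ** a) ` M = W \<inter> L_class M a"
  proof (intro subset_antisym Int_greatest Int_lower1 subsetI)
    show "b \<in> L_class M a" if "b \<in> W \<inter> (\<lambda>m. m ** a) ` M" for b
      using that by (intro W_L) simp_all
    show "b \<in> (\<lambda>m. m ** a) ` M" if "b \<in> W \<inter> L_class M a" for b
      using that by (auto simp: L_class_iff[OF mon])
  qed
  with open_W b0_W show thesis by (rule that)
qed

text \<open>
  If \<open>a = a y a\<close>, then right multiplication by the idempotent \<open>y a\<close> retracts \<open>M\<close> onto \<open>Ma\<close>.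
\<close>

lemma left_ideal_algebraic:
  fixes M :: "'n::finite cmat set"
  assumes mon: "matrix_submonoid M" and alg: "algebraic_set M" and reg: "regular_monoid M" and a: "a \<in> M"
  shows "algebraic_set ((\<lambda>m. m ** a) ` M)"
proof -
  have mul: "\<And>x y. x \<in> M \<Longrightarrow> y \<in> M \<Longrightarrow> x ** y \<in> M"
    using mon unfolding matrix_submonoid_def by auto
  obtain y where y: "y \<in> M" "a ** y ** a = a"
    using reg a unfolding regular_monoid_def by blast
  obtain Q where Q: "\<forall>q\<in>Q. polynomial_fun q" "M = {A. \<forall>q\<in>Q. q A = 0}"
    using alg unfolding algebraic_set_def by blast
  define f :: "'n \<times> 'n \<Rightarrow> 'n cmat \<Rightarrow> complex"
    where "f = (\<lambda>(i, j) A. (A ** (y ** a)) $ i $ j - A $ i $ j)"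
  have f: "polynomial_fun (f k)" for k
    using poly_in.add[OF poly_in_mult_right poly_in_uminus[OF poly_in_nth], of "y ** a" "fst k" "snd k" "fst k" "snd k"]
    by (simp add: polynomial_fun_iff f_def split_def)
  have "(\<lambda>m. m ** a) ` M = {b \<in> M. b ** (y ** a) = b}"
  proof (intro subset_antisym subsetI)
    fix b assume "b \<in> (\<lambda>m. m ** a) ` M"
    then obtain m where m: "m \<in> M" "b = m ** a" by blast
    have "(m ** a) ** (y ** a) = m ** (a ** y ** a)" by (simp only: matrix_mul_assoc)
    then show "b \<in> {b \<in> M. b ** (y ** a) = b}"
      using mul m a y(2) by simp
  next
    fix b assume "b \<in> {b \<in> M. b ** (y ** a) = b}"
    then have "b ** y ** a = b" "b ** y \<in> M"
      using mul y(1) by (auto simp: matrix_mul_assoc)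
    then have "b = (b ** y) ** a" "b ** y \<in> M" by simp_all
    then show "b \<in> (\<lambda>m. m ** a) ` M" by blast
  qed
  moreover have "b ** (y ** a) = b \<longleftrightarrow> (\<forall>k. f k b = 0)" for b
    by (simp add: f_def vec_eq_iff)
  then have "{b \<in> M. b ** (y ** a) = b} = {A. \<forall>q\<in>Q \<union> range f. q A = 0}"
    unfolding Q(2) by auto
  ultimately have "(\<lambda>m. m ** a) ` M = {A. \<forall>q\<in>Q \<union> range f. q A = 0}"
    by (rule trans)
  then show ?thesis
    unfolding algebraic_set_def using Q(1) f by (intro exI[of _ "Q \<union> range f"]) blast
qed

text \<open>
  Irreducibility enters as primality of the vanishing ideal, a form that is immediately
  inherited by the transposed monoid.
\<close>

lemma L_class_submanifold:
  fixes M :: "'n::finite cmat set"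
  assumes mon: "matrix_submonoid M" and alg: "algebraic_set M" and prime: "prime_on M"
    and reg: "regular_monoid M" and a: "a \<in> M"
  shows "complex_submanifold (L_class M a)"
proof -
  define X where "X = (\<lambda>m. m ** a) ` M"
  have X_alg: "algebraic_set X"
    unfolding X_def using mon alg reg a by (rule left_ideal_algebraic)
  have X_prime: "prime_on X"
    unfolding X_def using prime poly_in_mult_right by (rule prime_on_image)
  have "X \<noteq> {}" using a by (auto simp: X_def)
  then obtain T P s where sys: "generic_system X UNIV T P s"
    using generic_system_exists[OF X_prime _ finite] by blast
  then have s: "s \<in> poly_in UNIV" "\<not> vanishes_on s X" by (simp_all add: generic_system_def)
  have "slice_chart_at (card (- T)) (L_class M a) b" if b: "b \<in> L_class M a" for b
  proof -
    have Mb: "(\<lambda>m. m ** b) ` M = X" using b by (simp add: L_class_def X_def)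
    have sb: "(\<lambda>m. s (m ** b)) \<in> poly_in UNIV"
      using s(1) poly_in_mult_right by (rule poly_in_subst)
    have sb_nz: "\<not> vanishes_on (\<lambda>m. s (m ** b)) M"
      using s(2) unfolding Mb[symmetric] vanishes_on_def by simp
    have det_nz: "\<not> vanishes_on det M"
      using mon by (auto simp: vanishes_on_def matrix_submonoid_def intro!: bexI[of _ "mat 1"])
    have "\<not> vanishes_on (\<lambda>m. det m * s (m ** b)) M"
      by (rule prime_onD[OF prime poly_in_det sb det_nz sb_nz])
    \<comment> \<open>A unit of \<open>M\<close> that moves \<open>b\<close> to a generic point of \<open>X\<close>.\<close>
    then obtain g where g: "g \<in> M" "det g \<noteq> 0" "s (g ** b) \<noteq> 0"
      by (auto simp: vanishes_on_def)
    obtain h where h: "h \<in> M" "h ** g = mat 1" "g ** h = mat 1"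
      using unit_inverse_in_regular_monoid[OF reg g(1,2)] .
    have gb: "g ** b \<in> L_class M a" "g ** b \<in> X"
      using L_class_mult_unit[OF mon g(1) h(1,2) b] g(1) Mb by auto
    obtain W where "open W" "g ** b \<in> W" "W \<inter> X = W \<inter> L_class M a"
      using L_class_open_in_left_ideal[OF mon reg a gb(1)] unfolding X_def .
    then have chart: "slice_chart_at (card (- T)) (L_class M a) (g ** b)"
      by (rule generic_slice_chart[OF X_alg sys gb(2) g(3)])
    have image: "(\<lambda>A. g ** A) ` L_class M a = L_class M a"
    proof (intro subset_antisym subsetI)
      fix A assume "A \<in> L_class M a"
      then have "h ** A \<in> L_class M a" by (rule L_class_mult_unit[OF mon h(1) g(1) h(3)])
      moreover have "A = g ** (h ** A)" by (simp add: matrix_mul_assoc h(3))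
      ultimately show "A \<in> (\<lambda>A. g ** A) ` L_class M a" by (rule rev_image_eqI)
    qed (use L_class_mult_unit[OF mon g(1) h(1,2)] in auto)
    have lin: "linear (\<lambda>A. u ** A)" for u :: "'n cmat"
    proof (rule linearI)
      show "u ** (r *\<^sub>R A) = r *\<^sub>R (u ** A)" for r A
        by (simp add: matrix_matrix_mult_def vec_eq_iff scaleR_sum_right)
    qed (rule matrix_add_ldistrib)
    have scale: "u ** map_matrix ((*) c) A = map_matrix ((*) c) (u ** A)" for u A :: "'n cmat" and c
      by (simp add: matrix_matrix_mult_def vec_eq_iff sum_distrib_left mult_ac)
    show ?thesis
    proof (rule slice_chart_at_linear_iso[OF lin lin])
      show "h ** (g ** A) = A" "g ** (h ** A) = A" for A
        by (simp_all add: matrix_mul_assoc h(2,3))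
      show "slice_chart_at (card (- T)) ((\<lambda>A. g ** A) ` L_class M a) (g ** b)"
        unfolding image by (rule chart)
    qed (rule scale)+
  qed
  then show ?thesis
    unfolding complex_submanifold_iff by blast
qed

lemma R_class_transpose:
  fixes M :: "'n::finite cmat set"
  shows "transpose ` R_class M a = L_class (transpose ` M) (transpose a)"
proof -
  have ideal: "(\<lambda>m. m ** transpose b) ` transpose ` M = transpose ` (\<lambda>m. b ** m) ` M" for b :: "'n cmat"
    by (simp add: image_image matrix_transpose_mul)
  have inj: "inj (transpose :: 'n cmat \<Rightarrow> 'n cmat)" by (metis injI transpose_transpose)
  show ?thesis
    unfolding L_class_def R_class_def
  proof (intro set_eqI iffI)
    fix c assume "c \<in> transpose ` {b \<in> M. (\<lambda>m. b ** m) ` M = (\<lambda>m. a ** m) ` M}"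
    then obtain b where "c = transpose b" "b \<in> M" "(\<lambda>m. b ** m) ` M = (\<lambda>m. a ** m) ` M" by blast
    then show "c \<in> {b \<in> transpose ` M. (\<lambda>m. m ** b) ` transpose ` M = (\<lambda>m. m ** transpose a) ` transpose ` M}"
      using ideal[of b] ideal[of a] by simp
  next
    fix c assume "c \<in> {b \<in> transpose ` M. (\<lambda>m. m ** b) ` transpose ` M = (\<lambda>m. m ** transpose a) ` transpose ` M}"
    then obtain b where b: "c = transpose b" "b \<in> M"
      and "(\<lambda>m. m ** c) ` transpose ` M = (\<lambda>m. m ** transpose a) ` transpose ` M" by blast
    then have "transpose ` (\<lambda>m. b ** m) ` M = transpose ` (\<lambda>m. a ** m) ` M"
      using ideal[of b] ideal[of a] by simp
    then have "(\<lambda>m. b ** m) ` M = (\<lambda>m. a ** m) ` M"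
      using inj_image_eq_iff[OF inj] by blast
    then show "c \<in> transpose ` {b \<in> M. (\<lambda>m. b ** m) ` M = (\<lambda>m. a ** m) ` M}"
      using b by blast
  qed
qed

theorem proposition3p2:
  fixes M :: "(complex^'n^'n) set" and a :: "complex^'n^'n"
  assumes "algebraic_submonoid M"
    and "irreducible_set M"
    and "regular_monoid M"
    and "a \<in> M"
  shows "complex_submanifold (L_class M a) \<and> complex_submanifold (R_class M a)"
proof
  have mon: "matrix_submonoid M" and alg: "algebraic_set M"
    using assms(1) by (simp_all add: algebraic_submonoid_def)
  have prime: "prime_on M"
    using alg assms(2) by (rule irreducible_imp_prime_on)
  show "complex_submanifold (L_class M a)"
    using mon alg prime assms(3,4) by (rule L_class_submanifold)
  define N where "N = transpose ` M"
  have "matrix_submonoid N"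
    unfolding matrix_submonoid_def N_def
  proof (intro conjI ballI)
    show "mat 1 \<in> transpose ` M"
      using imageI[of "mat 1" M transpose] mon by (simp add: matrix_submonoid_def)
    fix x y assume "x \<in> transpose ` M" "y \<in> transpose ` M"
    then obtain u v where uv: "u \<in> M" "v \<in> M" "x = transpose u" "y = transpose v" by blast
    then have "v ** u \<in> M" using mon by (simp add: matrix_submonoid_def)
    moreover have "x ** y = transpose (v ** u)" by (simp add: uv matrix_transpose_mul)
    ultimately show "x ** y \<in> transpose ` M" by blast
  qed
  moreover have "algebraic_set N"
  proof -
    obtain Q where Q: "\<forall>q\<in>Q. polynomial_fun q" "M = {A. \<forall>q\<in>Q. q A = 0}"
      using alg unfolding algebraic_set_def by blast
    have "N = {A. \<forall>q\<in>(\<lambda>q A. q (transpose A)) ` Q. q A = 0}"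
    proof (intro set_eqI iffI)
      fix A assume "A \<in> {A. \<forall>q\<in>(\<lambda>q A. q (transpose A)) ` Q. q A = 0}"
      then have "transpose A \<in> M" unfolding Q(2) by simp
      then show "A \<in> N" unfolding N_def using imageI[of "transpose A" M transpose] by simp
    qed (use Q(2) in \<open>auto simp: N_def\<close>)
    moreover have "polynomial_fun (\<lambda>A. q (transpose A))" if "q \<in> Q" for q
      using Q(1) that poly_in_subst[OF _ poly_in_transpose, of q] by (simp add: polynomial_fun_iff)
    ultimately show ?thesis
      unfolding algebraic_set_def by (intro exI[of _ "(\<lambda>q A. q (transpose A)) ` Q"]) simp
  qed
  moreover have "prime_on N"
    unfolding N_def using prime poly_in_transpose by (rule prime_on_image)
  moreover have "regular_monoid N"
    unfolding regular_monoid_def N_def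
  proof (intro ballI)
    fix b assume "b \<in> transpose ` M"
    then obtain c where c: "b = transpose c" "c \<in> M" by blast
    then obtain x where x: "x \<in> M" "c ** x ** c = c"
      using assms(3) unfolding regular_monoid_def by blast
    have "b ** transpose x ** b = transpose (c ** x ** c)"
      by (simp add: c(1) matrix_transpose_mul matrix_mul_assoc)
    then show "\<exists>x\<in>transpose ` M. b ** x ** b = b"
      using x c(1) by auto
  qed
  moreover have "transpose a \<in> N" using assms(4) by (simp add: N_def)
  ultimately have "complex_submanifold (L_class N (transpose a))"
    by (rule L_class_submanifold)
  then obtain d where d: "\<And>b. b \<in> L_class N (transpose a) \<Longrightarrow> slice_chart_at d (L_class N (transpose a)) b"
    unfolding complex_submanifold_iff by blast
  have image: "transpose ` R_class M a = L_class N (transpose a)"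
    unfolding N_def by (rule R_class_transpose)
  have lin: "linear (transpose :: 'n cmat \<Rightarrow> 'n cmat)"
    by (rule linearI) (simp_all add: transpose_def vec_eq_iff)
  have "slice_chart_at d (R_class M a) b" if "b \<in> R_class M a" for b
  proof (rule slice_chart_at_linear_iso[of transpose transpose])
    show "slice_chart_at d (transpose ` R_class M a) (transpose b)"
      unfolding image using that image by (intro d) blast
  qed (simp_all add: lin, simp_all add: transpose_def vec_eq_iff)
  then show "complex_submanifold (R_class M a)"
    unfolding complex_submanifold_iff by blast
qed

end
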